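(* Let $\alpha\ge 1$ be real and $n\le 5$. Then for every positive semi-definite Hermitian $A=(a_{i,j})\in M_n(\mathbb C)$, $$\operatorname{per}_\alpha A\ge\alpha^n\prod_{i=1}^n a_{ii}\ge(-1)^n\operatorname{per}_{-\alpha}A.$$
   Context: For $A=(a_{i,j})\in M_n(\mathbb C)$ and a number $\alpha$, $\operatorname{per}_\alpha A=\sum_{\pi\in\mathfrak S_n}\alpha^{\nu(\pi)}\prod_{i=1}^n a_{i,\pi(i)}$, where $\mathfrak S_n$ is the symmetric group and $\nu(\pi)$ is the number of disjoint cycles of $\pi$ (fixed points counted). *)

theory Defs
  imports "HOL-Analysis.Analysis" "HOL-Library.Complex_Order" "HOL-Combinatorics.Orbits"
begin

text \<open>Matrices in M_n(C) are represented as functions nat => nat => complex,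
  with only the entries with indices in {0..<n} being relevant.\<close>

definition num_cycles :: "nat \<Rightarrow> (nat \<Rightarrow> nat) \<Rightarrow> nat" where
  "num_cycles n p = card ((\<lambda>x. orbit p x) ` {0..<n})"

definition per_alpha :: "complex \<Rightarrow> nat \<Rightarrow> (nat \<Rightarrow> nat \<Rightarrow> complex) \<Rightarrow> complex" where
  "per_alpha \<alpha> n A =
     (\<Sum>p\<in>{p. p permutes {0..<n}}. \<alpha> ^ num_cycles n p * (\<Prod>i<n. A i (p i)))"

definition hermitian_mat :: "nat \<Rightarrow> (nat \<Rightarrow> nat \<Rightarrow> complex) \<Rightarrow> bool" where
  "hermitian_mat n A \<longleftrightarrow> (\<forall>i<n. \<forall>j<n. A j i = cnj (A i j))"

definition psd_mat :: "nat \<Rightarrow> (nat \<Rightarrow> nat \<Rightarrow> complex) \<Rightarrow> bool" where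
  "psd_mat n A \<longleftrightarrow> (\<forall>x :: nat \<Rightarrow> complex. 0 \<le> (\<Sum>i<n. \<Sum>j<n. cnj (x i) * A i j * x j))"

end

theory Submission
  imports Defs
begin

text \<open>
  Put \<open>\<beta> = \<plusminus>1/\<alpha>\<close>, so that \<open>|\<beta>| \<le> 1\<close>, and let \<open>P\<^sub>n\<close> be the sum of
  \<open>\<beta> ^ (n - \<nu> p) \<Prod>i. a\<^sub>i\<^sub>,\<^sub>p\<^sub>i\<close> over \<open>p \<in> S\<^sub>n\<close>. Both inequalities say that
  \<open>(P\<^sub>n - \<Prod>i. a\<^sub>i\<^sub>i) / \<beta> \<ge> 0\<close>. Removing the last index \<open>n\<close> from its cycle gives
  \<open>P\<^sub>n\<^sub>+\<^sub>1 = a\<^sub>n\<^sub>n P\<^sub>n + \<beta> \<Sum>q \<in> S\<^sub>n. \<beta> ^ (n - \<nu> q) F\<^sub>n q\<close>, where \<open>F\<^sub>n\<close> is a positive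
  definite function on \<open>S\<^sub>n\<close> by the Schur product theorem. Hence the last sum is at least
  \<open>c\<^sub>n F\<^sub>n(id)\<close>, where \<open>c\<^sub>n\<close> is the least eigenvalue of \<open>\<Sum>q. |\<beta>| ^ (n - \<nu> q) q\<close> in the group
  algebra, and \<open>F\<^sub>n(id)\<close> is the sum over \<open>i < n\<close> of \<open>|a\<^sub>i\<^sub>n|\<^sup>2\<close> times the remaining diagonal
  entries. The \<open>c\<^sub>n\<close> may be negative, but after averaging over all orderings of the indices only
  \<open>\<Sum>k<n. k c\<^sub>k \<ge> 0\<close> is needed, and this holds for \<open>n \<le> 5\<close>.
\<close>

subsection \<open>Cycle counts and cycle-weighted sums\<close>

lemma orbit_eq_of_mem:
  assumes "permutation p" "y \<in> orbit p x"
  shows "orbit p y = orbit p x"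
  using orbit_cyclic_eq3[OF cyclic_on_orbit'[OF assms(1)] assms(2)] .

text \<open>Composing with the transposition inserts \<open>n\<close> into a cycle of
  \<open>q\<close> directly before \<open>b\<close>; every other step of \<open>q\<close> is
  kept.\<close>

lemma orbit_insert_into_cycle:
  fixes n b :: nat
  assumes q: "q permutes {0..<n}" and b: "b < n" and x: "x < n"
  shows "orbit (Transposition.transpose n b \<circ> q) x - {n} = orbit q x" (is "orbit ?p x - _ = _")
proof (intro equalityI subsetI)
  have qn: "q n = n" using q by (simp add: permutes_def)
  have pn: "?p n = b" by (simp add: qn)
  have lt: "q z < n \<longleftrightarrow> z < n" for z
    using permutes_in_image[OF q, of z] by simp
  fix y assume "y \<in> orbit ?p x - {n}"
  then have "y \<in> orbit ?p x" "y \<noteq> n" by auto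
  \<comment> \<open>Invariant of the walk: when it stands at \<open>n\<close>, the step of
    \<open>q\<close> that was interrupted is the one into \<open>b\<close>.\<close>
  have "if y = n then b \<in> orbit q x else y \<in> orbit q x"
    using \<open>y \<in> orbit ?p x\<close>
  proof induction
    case base
    then show ?case
      using lt[of x] x b orbit.base[of q x] by (auto simp: Transposition.transpose_def)
  next
    case (step z)
    show ?case
    proof (cases "z = n")
      case True
      then show ?thesis using step pn b by auto
    next
      case False
      then have "q z \<in> orbit q x" using step by (auto intro: orbit.step)
      moreover have "q z \<noteq> n" using False q
        by (metis permutes_def qn)
      ultimately show ?thesis using b by (auto simp: Transposition.transpose_def)
    qed
  qed
  then show "y \<in> orbit q x" using \<open>y \<noteq> n\<close> by simp
next
  have qn: "q n = n" using q by (simp add: permutes_def)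
  have pn: "?p n = b" by (simp add: qn)
  have lt: "q z < n \<longleftrightarrow> z < n" for z
    using permutes_in_image[OF q, of z] by simp
  \<comment> \<open>One step of \<open>q\<close> is one step of \<open>?p\<close>, or two steps if
    it passes through \<open>n\<close>.\<close>
  have step: "q z \<in> orbit ?p x" if z: "z < n" "?p z \<in> orbit ?p x" for z
  proof (cases "q z = b")
    case True
    then have "n \<in> orbit ?p x" using z by simp
    then have "?p n \<in> orbit ?p x" by (rule orbit.step)
    then show ?thesis using pn True by simp
  next
    case False
    then have "?p z = q z" using z lt[of z] by (auto simp: Transposition.transpose_def)
    then show ?thesis using z by simp
  qed
  fix y assume "y \<in> orbit q x"
  then have "y < n \<and> y \<in> orbit ?p x"
  proof induction
    case base
    then show ?case using x lt[of x] step[of x] orbit.base[of ?p x] by blast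
  next
    case (step z)
    then show ?case using lt[of z] \<open>\<And>z. \<lbrakk>z < n; ?p z \<in> orbit ?p x\<rbrakk> \<Longrightarrow> q z \<in> orbit ?p x\<close>[of z]
      orbit.step[of z ?p x] by blast
  qed
  then show "y \<in> orbit ?p x - {n}" by simp
qed

lemma permutation_of_permutes_upt: "p permutes {0..<n::nat} \<Longrightarrow> permutation p"
  using permutation_permutes by blast

lemma num_cycles_insert_into_cycle:
  assumes q: "q permutes {0..<n}" and b: "b < n"
  shows "num_cycles (Suc n) (Transposition.transpose n b \<circ> q) = num_cycles n q"
proof -
  let ?p = "Transposition.transpose n b \<circ> q"
  have qn: "q n = n" using q by (simp add: permutes_def)
  have "?p permutes {0..<Suc n}"
    using q b by (intro permutes_compose permutes_swap_id permutes_subset[OF q]) auto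
  then have perm: "permutation ?p" by (rule permutation_of_permutes_upt)
  have "?p n \<in> orbit ?p n" by (rule orbit.base)
  then have "orbit ?p n = orbit ?p b"
    using orbit_eq_of_mem[OF perm, of b n] by (simp add: qn)
  then have "orbit ?p ` {0..<Suc n} = orbit ?p ` {0..<n}"
    using b by (auto simp: atLeast0_lessThan_Suc)
  \<comment> \<open>As \<open>n\<close> shares the orbit of \<open>b\<close>, it adds no cycle, and
    deleting it matches the cycles of \<open>?p\<close> with those of \<open>q\<close>.\<close>
  moreover have "bij_betw (\<lambda>S. S - {n}) (orbit ?p ` {0..<n}) (orbit q ` {0..<n})"
  proof (rule bij_betw_imageI)
    show "inj_on (\<lambda>S. S - {n}) (orbit ?p ` {0..<n})"
    proof (rule inj_onI, clarify)
      fix x y assume xy: "x \<in> {0..<n}" "y \<in> {0..<n}" and eq: "orbit ?p x - {n} = orbit ?p y - {n}"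
      have "x \<in> orbit ?p x - {n}"
        using permutation_self_in_orbit[OF perm] xy by simp
      then have "x \<in> orbit ?p y" using eq by auto
      then show "orbit ?p x = orbit ?p y" by (rule orbit_eq_of_mem[OF perm])
    qed
    show "(\<lambda>S. S - {n}) ` orbit ?p ` {0..<n} = orbit q ` {0..<n}"
      unfolding image_image
      by (rule image_cong[OF refl], rule orbit_insert_into_cycle[OF q b]) simp
  qed
  ultimately show ?thesis
    unfolding num_cycles_def by (metis bij_betw_same_card)
qed

lemma num_cycles_insert_fixpoint:
  assumes q: "q permutes {0..<n}"
  shows "num_cycles (Suc n) q = Suc (num_cycles n q)"
proof -
  have qn: "q n = n" using q by (simp add: permutes_def)
  then have "orbit q n = {n}" by (simp add: orbit_eq_singleton_iff)
  moreover have "{n} \<notin> orbit q ` {0..<n}"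
    using permutation_self_in_orbit[OF permutation_of_permutes_upt[OF q]] by fastforce
  ultimately show ?thesis
    by (simp add: num_cycles_def atLeast0_lessThan_Suc)
qed

lemma num_cycles_le: "num_cycles n p \<le> n"
  unfolding num_cycles_def using card_image_le[of "{0..<n}" "orbit p"] by simp

lemma orbit_conjugate:
  assumes comm: "\<And>x. p' (s x) = s (p x)"
  shows "orbit p' (s x) = s ` orbit p x"
proof -
  have "(p' ^^ k) (s x) = s ((p ^^ k) x)" for k
    by (induction k) (simp_all add: comm)
  then show ?thesis by (auto simp: orbit_altdef)
qed

lemma num_cycles_conjugate:
  assumes s: "s permutes {0..<n}"
  shows "num_cycles n (s \<circ> p \<circ> inv s) = num_cycles n p"
proof -
  let ?p = "s \<circ> p \<circ> inv s"
  have "inj s" using s by (rule permutes_inj)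
  have *: "orbit ?p (s x) = s ` orbit p x" for x
    by (rule orbit_conjugate) (simp add: inv_f_f[OF \<open>inj s\<close>])
  have "orbit ?p ` {0..<n} = orbit ?p ` s ` {0..<n}"
    by (simp only: permutes_image[OF s])
  also have "\<dots> = (`) s ` orbit p ` {0..<n}"
    by (simp only: image_image *)
  finally show ?thesis
    unfolding num_cycles_def
    using card_image[of "(`) s" "orbit p ` {0..<n}"] \<open>inj s\<close>
    by (simp add: inj_on_def inj_image_eq_iff del: comp_apply)
qed

text \<open>The exponent is the least number of transpositions with product \<open>p\<close>, so a
  new fixed point leaves it alone. The function \<open>f\<close> is arbitrary, to cover both matrix
  products and positive definite functions.\<close>

definition cycle_sum :: "complex \<Rightarrow> nat \<Rightarrow> ((nat \<Rightarrow> nat) \<Rightarrow> complex) \<Rightarrow> complex" where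
  "cycle_sum \<beta> n f = (\<Sum>p | p permutes {0..<n}. \<beta> ^ (n - num_cycles n p) * f p)"

lemma cycle_sum_0 [simp]: "cycle_sum \<beta> 0 f = f id"
  by (simp add: cycle_sum_def num_cycles_def)

text \<open>Each permutation of \<open>n + 1\<close> letters is uniquely
  \<open>transpose n b \<circ> q\<close>. For \<open>b = n\<close> it fixes \<open>n\<close>; for
  \<open>b < n\<close> it has as many cycles as \<open>q\<close> but one more letter, which costs a
  factor \<beta>.\<close>

lemma cycle_sum_Suc:
  "cycle_sum \<beta> (Suc n) f =
     cycle_sum \<beta> n f + \<beta> * (\<Sum>b<n. cycle_sum \<beta> n (\<lambda>q. f (Transposition.transpose n b \<circ> q)))"
proof -
  have 1: "\<beta> ^ (Suc n - num_cycles (Suc n) q) = \<beta> ^ (n - num_cycles n q)"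
    if "q permutes {0..<n}" for q
    using num_cycles_insert_fixpoint[OF that] by simp
  have 2: "\<beta> ^ (Suc n - num_cycles (Suc n) (Transposition.transpose n b \<circ> q)) = \<beta> * \<beta> ^ (n - num_cycles n q)"
    if "q permutes {0..<n}" "b < n" for q b
    using num_cycles_insert_into_cycle[OF that] num_cycles_le[of n q] by (simp add: Suc_diff_le)
  have "{0..<Suc n} = insert n {0..<n}" by auto
  then have "cycle_sum \<beta> (Suc n) f =
    (\<Sum>b\<in>insert n {0..<n}. \<Sum>q | q permutes {0..<n}.
       \<beta> ^ (Suc n - num_cycles (Suc n) (Transposition.transpose n b \<circ> q)) *
       f (Transposition.transpose n b \<circ> q))"
    unfolding cycle_sum_def by (simp only:) (rule sum_over_permutations_insert; simp)
  also have "\<dots> = (\<Sum>q | q permutes {0..<n}. \<beta> ^ (n - num_cycles n q) * f q) +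
     (\<Sum>b<n. \<Sum>q | q permutes {0..<n}. \<beta> * (\<beta> ^ (n - num_cycles n q) *
       f (Transposition.transpose n b \<circ> q)))"
    by (subst sum.insert) (auto simp: atLeast0LessThan[symmetric] 1 2 mult.assoc intro!: arg_cong2[where f = "(+)"] sum.cong)
  finally show ?thesis
    by (simp add: cycle_sum_def sum_distrib_left)
qed

lemma cycle_sum_cong:
  "(\<And>p. p permutes {0..<n} \<Longrightarrow> f p = g p) \<Longrightarrow> cycle_sum \<beta> n f = cycle_sum \<beta> n g"
  unfolding cycle_sum_def by (rule sum.cong) auto

lemma cycle_sum_scale: "cycle_sum \<beta> n (\<lambda>p. c * f p) = c * cycle_sum \<beta> n f"
  by (simp add: cycle_sum_def sum_distrib_left mult.left_commute)

lemma cycle_sum_sum: "cycle_sum \<beta> n (\<lambda>p. \<Sum>i\<in>I. f i p) = (\<Sum>i\<in>I. cycle_sum \<beta> n (f i))"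
  by (simp add: cycle_sum_def sum_distrib_left sum.swap[of _ I])

lemma cycle_sum_one: "cycle_sum 1 n f = (\<Sum>p | p permutes {0..<n}. f p)"
  by (simp add: cycle_sum_def)

text \<open>The sign is -1 to the power \<open>n - num_cycles n p\<close>. This lets negative
  weights be reduced to positive ones.\<close>

lemma cycle_sum_sign:
  "cycle_sum \<beta> n (\<lambda>p. of_int (sign p) * f p) = cycle_sum (- \<beta>) n f"
proof (induction n arbitrary: f)
  case (Suc n)
  have "cycle_sum \<beta> n (\<lambda>q. of_int (sign (Transposition.transpose n b \<circ> q)) * f (Transposition.transpose n b \<circ> q))
     = cycle_sum (- \<beta>) n (\<lambda>q. - f (Transposition.transpose n b \<circ> q))" if "b < n" for b
    unfolding Suc.IH[symmetric]
    by (rule cycle_sum_cong)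
      (use that in \<open>simp add: sign_compose sign_swap_id permutation_swap_id permutation_of_permutes_upt\<close>)
  moreover have "cycle_sum (- \<beta>) n (\<lambda>q. - g q) = - cycle_sum (- \<beta>) n g" for g
    using cycle_sum_scale[of "-\<beta>" n "-1" g] by simp
  ultimately show ?case
    by (simp add: cycle_sum_Suc Suc.IH sum_negf)
qed simp

lemma per_alpha_eq_cycle_sum:
  assumes "\<gamma> \<noteq> 0"
  shows "per_alpha \<gamma> n A = \<gamma> ^ n * cycle_sum (1 / \<gamma>) n (\<lambda>p. \<Prod>i<n. A i (p i))"
  unfolding per_alpha_def cycle_sum_def sum_distrib_left
proof (rule sum.cong[OF refl])
  fix p
  have "\<gamma> ^ num_cycles n p = \<gamma> ^ n * (1 / \<gamma>) ^ (n - num_cycles n p)"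
    using assms num_cycles_le[of n p] by (simp add: power_diff power_one_over)
  then show "\<gamma> ^ num_cycles n p * (\<Prod>i<n. A i (p i)) =
         \<gamma> ^ n * ((1 / \<gamma>) ^ (n - num_cycles n p) * (\<Prod>i<n. A i (p i)))"
    by simp
qed

text \<open>Relabelling the indices conjugates the permutation, and conjugation preserves the number
  of cycles.\<close>

lemma cycle_sum_relabel:
  assumes s: "s permutes {0..<n}"
  shows "cycle_sum \<beta> n (\<lambda>p. \<Prod>i<n. A (s i) (s (p i))) = cycle_sum \<beta> n (\<lambda>p. \<Prod>i<n. A i (p i))"
proof -
  let ?S = "{p. p permutes {0..<n}}"
  have s': "inv s permutes {0..<n}" using s by (rule permutes_inv)
  have "cycle_sum \<beta> n (\<lambda>p. \<Prod>i<n. A i (p i)) =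
    (\<Sum>p\<in>?S. \<beta> ^ (n - num_cycles n (s \<circ> (p \<circ> inv s))) * (\<Prod>i<n. A i ((s \<circ> (p \<circ> inv s)) i)))"
    unfolding cycle_sum_def
    by (subst setum_permutations_compose_left[OF s], subst sum_permutations_compose_right[OF s']) simp
  also have "\<dots> = cycle_sum \<beta> n (\<lambda>p. \<Prod>i<n. A (s i) (s (p i)))"
    unfolding cycle_sum_def
  proof (rule sum.cong[OF refl])
    fix p
    have "(\<Prod>i<n. A i (s (p (inv s i)))) = (\<Prod>i<n. A (s i) (s (p i)))"
      using prod.permute[OF s, of "\<lambda>i. A i (s (p (inv s i)))"]
      by (simp add: o_def permutes_inverses[OF s] atLeast0LessThan)
    then show "\<beta> ^ (n - num_cycles n (s \<circ> (p \<circ> inv s))) * (\<Prod>i<n. A i ((s \<circ> (p \<circ> inv s)) i)) =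
      \<beta> ^ (n - num_cycles n p) * (\<Prod>i<n. A (s i) (s (p i)))"
      by (simp only: o_assoc num_cycles_conjugate[OF s]) simp
  qed
  finally show ?thesis by simp
qed

subsection \<open>Gram matrices\<close>

lemma nonneg_cnj_mult_self: "0 \<le> cnj z * (z::complex)"
  by (simp add: less_eq_complex_def)

lemma nonneg_of_nat_mult_cancel:
  fixes z :: complex
  assumes "0 < m" "0 \<le> of_nat m * z"
  shows "0 \<le> z"
  using assms by (auto simp: less_eq_complex_def zero_le_mult_iff)

lemma scaled_nonneg: "0 \<le> r \<Longrightarrow> 0 \<le> z \<Longrightarrow> 0 \<le> complex_of_real r * z"
  by (intro mult_nonneg_nonneg) (auto simp: less_eq_complex_def)

lemma prod_nonneg_complex: "(\<And>i. i \<in> I \<Longrightarrow> 0 \<le> (f i :: complex)) \<Longrightarrow> 0 \<le> prod f I"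
  by (induction I rule: infinite_finite_induct) (auto simp: less_eq_complex_def)

text \<open>Positive semi-definiteness in factored form, where \<open>u r i\<close> is coordinate
  \<open>r\<close> of the vector of index \<open>i\<close>. Restriction, relabelling and Schur
  products are immediate in this form.\<close>

definition gram_on :: "nat set \<Rightarrow> (nat \<Rightarrow> nat \<Rightarrow> complex) \<Rightarrow> bool" where
  "gram_on S A \<longleftrightarrow> (\<exists>N (u :: nat \<Rightarrow> nat \<Rightarrow> complex). \<forall>i\<in>S. \<forall>j\<in>S. A i j = (\<Sum>r<N. cnj (u r i) * u r j))"

lemma gram_onE:
  assumes "gram_on S A"
  obtains N :: nat and u :: "nat \<Rightarrow> nat \<Rightarrow> complex"
    where "\<And>i j. i \<in> S \<Longrightarrow> j \<in> S \<Longrightarrow> A i j = (\<Sum>r<N. cnj (u r i) * u r j)"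
  using assms unfolding gram_on_def by (elim exE) (rule that, simp)

lemma gram_on_subset: "gram_on S A \<Longrightarrow> T \<subseteq> S \<Longrightarrow> gram_on T A"
  unfolding gram_on_def by (elim exE) (intro exI ballI; simp add: subset_iff)

lemma gram_on_relabel: "gram_on (f ` S) A \<Longrightarrow> gram_on S (\<lambda>i j. A (f i) (f j))"
proof -
  assume "gram_on (f ` S) A"
  then obtain N :: nat and u where "\<And>i j. i \<in> f ` S \<Longrightarrow> j \<in> f ` S \<Longrightarrow> A i j = (\<Sum>r<N. cnj (u r i) * u r j)"
    by (rule gram_onE) simp
  then have "\<forall>i\<in>S. \<forall>j\<in>S. A (f i) (f j) = (\<Sum>r<N. cnj (u r (f i)) * u r (f j))"
    by simp
  then show ?thesis unfolding gram_on_def by (intro exI[of _ N] exI[of _ "\<lambda>r i. u r (f i)"])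
qed

lemma gram_on_cnj:
  assumes "gram_on S A" "i \<in> S" "j \<in> S"
  shows "A j i = cnj (A i j)"
proof -
  obtain N :: nat and u where "\<And>i j. i \<in> S \<Longrightarrow> j \<in> S \<Longrightarrow> A i j = (\<Sum>r<N. cnj (u r i) * u r j)"
    using assms(1) by (rule gram_onE) simp
  from this[OF assms(3,2)] this[OF assms(2,3)] show ?thesis
    by (simp add: mult.commute)
qed

lemma gram_on_diag_nonneg:
  assumes "gram_on S A" "i \<in> S"
  shows "0 \<le> A i i"
proof -
  obtain N :: nat and u where "\<And>i j. i \<in> S \<Longrightarrow> j \<in> S \<Longrightarrow> A i j = (\<Sum>r<N. cnj (u r i) * u r j)"
    using assms(1) by (rule gram_onE) simp
  from this[OF assms(2,2)] show ?thesis by (simp only:) (rule sum_nonneg, rule nonneg_cnj_mult_self)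
qed

section \<open>Positive semi-definite matrices are Gram matrices\<close>

lemma psd_mat_diag_nonneg:
  assumes "psd_mat n A" "k < n"
  shows "0 \<le> A k k"
proof -
  have "(\<Sum>i<n. \<Sum>j<n. cnj (if i = k then 1 else 0) * A i j * (if j = k then 1 else 0)) = A k k"
    using assms(2) by (simp add: if_distrib[of cnj] mult_delta_left mult_delta_right cong: if_cong)
  moreover have "0 \<le> (\<Sum>i<n. \<Sum>j<n. cnj (if i = k then 1 else 0) * A i j * (if j = k then 1 else 0))"
    using assms(1)[unfolded psd_mat_def, rule_format, of "\<lambda>i. if i = k then 1 else 0"] .
  ultimately show ?thesis by simp
qed

lemma quadratic_form_Suc:
  fixes A :: "nat \<Rightarrow> nat \<Rightarrow> complex"
  shows "(\<Sum>i<Suc n. \<Sum>j<Suc n. cnj (x i) * A i j * x j) =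
    (\<Sum>i<n. \<Sum>j<n. cnj (x i) * A i j * x j) + (\<Sum>i<n. cnj (x i) * A i n) * x n
     + cnj (x n) * (\<Sum>j<n. A n j * x j) + cnj (x n) * A n n * x n"
  by (simp add: sum.distrib sum_distrib_left sum_distrib_right mult.assoc add.assoc)

lemma psd_mat_zero_diag:
  assumes psd: "psd_mat (Suc n) A" and herm: "hermitian_mat (Suc n) A"
    and 0: "A n n = 0" and k: "k < n"
  shows "A k n = 0"
proof (rule ccontr)
  assume nz: "A k n \<noteq> 0"
  \<comment> \<open>The last coordinate of \<open>x\<close> is scaled so that both cross terms equal
    \<open>t\<close>; the form then has the negative value \<open>- A k k - 2\<close>.\<close>
  define t where "t = complex_of_real (- (Re (A k k) + 1))"
  define x where "x i = (if i = k then 1 else if i = n then t * cnj (A k n) / (A k n * cnj (A k n)) else 0)" for i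
  have Ank: "A n k = cnj (A k n)" using herm[unfolded hermitian_mat_def, rule_format, of k n] k by simp
  have x: "(\<Sum>i<n. \<Sum>j<n. cnj (x i) * A i j * x j) = A k k"
    "(\<Sum>i<n. cnj (x i) * A i n) = A k n" "(\<Sum>j<n. A n j * x j) = A n k"
  proof -
    have xi: "x i = (if i = k then 1 else 0)" if "i < n" for i using that by (simp add: x_def)
    show "(\<Sum>i<n. \<Sum>j<n. cnj (x i) * A i j * x j) = A k k"
      "(\<Sum>i<n. cnj (x i) * A i n) = A k n" "(\<Sum>j<n. A n j * x j) = A n k"
      using k by (simp_all add: xi if_distrib[of cnj] mult_delta_left mult_delta_right cong: if_cong)
  qed
  have xn: "A k n * x n = t" "cnj (x n) * A n k = t"
    using nz k by (simp_all add: x_def Ank field_simps t_def)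
  have "0 \<le> (\<Sum>i<Suc n. \<Sum>j<Suc n. cnj (x i) * A i j * x j)"
    using psd unfolding psd_mat_def by blast
  then have "0 \<le> A k k + A k n * x n + cnj (x n) * A n k"
    unfolding quadratic_form_Suc x 0 by simp
  then have "0 \<le> A k k + t + t" using xn by simp
  moreover have "0 \<le> A k k" using psd_mat_diag_nonneg[OF psd] k by simp
  ultimately show False by (simp add: less_eq_complex_def t_def)
qed

text \<open>Cholesky factorisation: the Schur complement of the last diagonal entry is again positive.\<close>

lemma gram_on_of_psd_mat:
  "hermitian_mat n A \<Longrightarrow> psd_mat n A \<Longrightarrow> gram_on {..<n} A"
proof (induction n arbitrary: A)
  case 0
  then show ?case by (simp add: gram_on_def)
next
  case (Suc n)
  note herm = Suc.prems(1) and psd = Suc.prems(2)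
  define a where "a = Re (A n n)"
  have Ann: "A n n = complex_of_real a" "a \<ge> 0"
    using psd_mat_diag_nonneg[OF psd, of n] by (auto simp: a_def less_eq_complex_def complex_eq_iff)
  have H: "A j i = cnj (A i j)" if "i \<le> n" "j \<le> n" for i j
    using herm[unfolded hermitian_mat_def, rule_format, of i j] that by simp
  \<comment> \<open>If \<open>a = 0\<close>, the quotient is 0 by convention and \<open>B\<close> is
    \<open>A\<close>; the fact \<open>zero\<close> covers this case.\<close>
  define B where "B i j = A i j - A i n * A n j / a" for i j
  have zero: "A i n = 0" if "a = 0" "i \<le> n" for i
    using psd_mat_zero_diag[OF psd herm, of i] that Ann by (cases "i = n") auto
  have "hermitian_mat n B"
    unfolding hermitian_mat_def B_def
  proof (intro allI impI)
    fix i j assume "i < n" "j < n"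
    then show "A j i - A j n * A n i / a = cnj (A i j - A i n * A n j / a)"
      using H[of i j] H[of j n] H[of i n] by (simp add: mult.commute)
  qed
  moreover have "psd_mat n B"
    unfolding psd_mat_def
  proof
    fix x :: "nat \<Rightarrow> complex"
    define s where "s = (\<Sum>j<n. A n j * x j)"
    \<comment> \<open>Completing the square: this last coordinate minimises the form of
      \<open>A\<close>, and the minimum is the form of \<open>B\<close> at \<open>x\<close>.\<close>
    define y where "y i = (if i = n then - s / a else x i)" for i
    have cs: "(\<Sum>i<n. cnj (x i) * A i n) = cnj s"
      unfolding s_def cnj_sum by (rule sum.cong) (use H[of _ n] in \<open>simp_all add: mult.commute\<close>)
    have s0: "s = 0" if "a = 0"
      unfolding s_def using zero[OF that] H[of _ n] by simp
    have yx: "y i = x i" if "i < n" for i using that by (simp add: y_def)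
    have "0 \<le> (\<Sum>i<Suc n. \<Sum>j<Suc n. cnj (y i) * A i j * y j)"
      using psd unfolding psd_mat_def by blast
    also have "\<dots> = (\<Sum>i<n. \<Sum>j<n. cnj (x i) * A i j * x j) - cnj s * s / a"
      unfolding quadratic_form_Suc
      by (cases "a = 0") (simp_all add: yx cs s_def[symmetric] s0, simp_all add: y_def Ann field_simps)
    also have "cnj s * s / a = (\<Sum>i<n. \<Sum>j<n. cnj (x i) * (A i n * A n j / a) * x j)"
      unfolding cs[symmetric] unfolding s_def
      by (simp only: sum_product sum_divide_distrib) (simp add: mult_ac)
    finally show "0 \<le> (\<Sum>i<n. \<Sum>j<n. cnj (x i) * B i j * x j)"
      unfolding B_def by (simp add: algebra_simps sum_subtractf)
  qed
  ultimately have "gram_on {..<n} B" by (rule Suc.IH)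
  then obtain N :: nat and u where u: "\<And>i j. i < n \<Longrightarrow> j < n \<Longrightarrow> B i j = (\<Sum>r<N. cnj (u r i) * u r j)"
    by (rule gram_onE) (simp add: lessThan_def)
  \<comment> \<open>The new coordinate \<open>N\<close> supplies the rank one part that was
    subtracted to get \<open>B\<close>; the old coordinates are 0 at index \<open>n\<close>.\<close>
  define w where "w r i = (if r = N then A n i / sqrt a else if i < n then u r i else 0)"
    for r i
  have sq: "complex_of_real (sqrt a) * complex_of_real (sqrt a) = a"
    using Ann by (simp flip: of_real_mult)
  have last: "cnj (w N i) * w N j = A i n * A n j / a" if "i \<le> n" for i j
    using H[of n i] that sq by (simp add: w_def)
  have "A i j = (\<Sum>r<Suc N. cnj (w r i) * w r j)" if "i \<le> n" "j \<le> n" for i j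
  proof (cases "i < n \<and> j < n")
    case True
    then have "(\<Sum>r<N. cnj (w r i) * w r j) = B i j"
      by (simp add: w_def u)
    then show ?thesis using last[OF that(1)] by (simp add: B_def)
  next
    case False
    then have "(\<Sum>r<N. cnj (w r i) * w r j) = 0"
      using that by (intro sum.neutral) (auto simp: w_def)
    moreover have "A i n * A n j / a = A i j"
    proof (cases "a = 0")
      case True
      have "A i j = 0"
        using False that zero[OF True] H[of j n] by (cases "i = n"; cases "j = n"; simp)
      then show ?thesis using True by simp
    next
      case a: False
      then show ?thesis using False that Ann by (cases "i = n"; cases "j = n"; simp)
    qed
    ultimately show ?thesis using last[OF that(1)] by simp
  qed
  then have "\<forall>i\<in>{..<Suc n}. \<forall>j\<in>{..<Suc n}. A i j = (\<Sum>r<Suc N. cnj (w r i) * w r j)"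
    by (simp add: less_Suc_eq_le)
  then show ?case unfolding gram_on_def by (intro exI)
qed

text \<open>The Schur product theorem: each Gram factor can be absorbed into the test vector \<open>x\<close>.\<close>

lemma gram_kernel_product_nonneg:
  assumes A: "gram_on S A" and J: "finite J"
    and f: "\<And>j s. j \<in> J \<Longrightarrow> s \<in> T \<Longrightarrow> f j s \<in> S"
  shows "0 \<le> (\<Sum>s\<in>T. \<Sum>t\<in>T. cnj (x s) * x t * (\<Prod>j\<in>J. A (f j s) (f j t)))"
  using J f
proof (induction J arbitrary: x)
  case empty
  have "(\<Sum>s\<in>T. \<Sum>t\<in>T. cnj (x s) * x t) = cnj (\<Sum>s\<in>T. x s) * (\<Sum>s\<in>T. x s)"
    by (simp add: sum_product)
  then show ?case by (simp only: prod.empty mult_1_right nonneg_cnj_mult_self)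
next
  case (insert k J)
  obtain N :: nat and u where u: "\<And>i j. i \<in> S \<Longrightarrow> j \<in> S \<Longrightarrow> A i j = (\<Sum>r<N. cnj (u r i) * u r j)"
    using A by (rule gram_onE) simp
  let ?y = "\<lambda>r s. u r (f k s) * x s"
  let ?P = "\<lambda>s t. \<Prod>j\<in>J. A (f j s) (f j t)"
  have "(\<Sum>s\<in>T. \<Sum>t\<in>T. cnj (x s) * x t * (\<Prod>j\<in>insert k J. A (f j s) (f j t)))
      = (\<Sum>s\<in>T. \<Sum>t\<in>T. \<Sum>r<N. cnj (?y r s) * ?y r t * ?P s t)"
  proof (intro sum.cong refl)
    fix s t assume "s \<in> T" "t \<in> T"
    then have "A (f k s) (f k t) = (\<Sum>r<N. cnj (u r (f k s)) * u r (f k t))"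
      using insert.prems by (intro u) auto
    then show "cnj (x s) * x t * (\<Prod>j\<in>insert k J. A (f j s) (f j t))
       = (\<Sum>r<N. cnj (?y r s) * ?y r t * ?P s t)"
      using insert.hyps by (simp add: sum_distrib_left sum_distrib_right mult_ac)
  qed
  also have "\<dots> = (\<Sum>r<N. \<Sum>s\<in>T. \<Sum>t\<in>T. cnj (?y r s) * ?y r t * ?P s t)"
    by (simp add: sum.swap[of _ _ "{..<N}"])
  also have "0 \<le> \<dots>"
    using insert.prems by (intro sum_nonneg insert.IH) auto
  finally show ?case .
qed

subsection \<open>Positive definite functions on symmetric groups\<close>

definition positive_definite_fun :: "nat \<Rightarrow> ((nat \<Rightarrow> nat) \<Rightarrow> complex) \<Rightarrow> bool" where
  "positive_definite_fun n F \<longleftrightarrow> (\<forall>x. 0 \<le> (\<Sum>p | p permutes {0..<n}. \<Sum>q | q permutes {0..<n}.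
     cnj (x p) * x q * F (q \<circ> inv p)))"

text \<open>The sign is a real one-dimensional character, so it can be absorbed into the test
  vector.\<close>

lemma positive_definite_fun_sign:
  assumes "positive_definite_fun n F"
  shows "positive_definite_fun n (\<lambda>p. of_int (sign p) * F p)"
  unfolding positive_definite_fun_def
proof
  fix x :: "(nat \<Rightarrow> nat) \<Rightarrow> complex"
  let ?y = "\<lambda>p. of_int (sign p) * x p"
  have "(\<Sum>p | p permutes {0..<n}. \<Sum>q | q permutes {0..<n}.
          cnj (x p) * x q * (of_int (sign (q \<circ> inv p)) * F (q \<circ> inv p))) =
        (\<Sum>p | p permutes {0..<n}. \<Sum>q | q permutes {0..<n}.
          cnj (?y p) * ?y q * F (q \<circ> inv p))"
    by (intro sum.cong refl)
      (simp add: sign_compose sign_inverse permutation_of_permutes_upt permutation_inverse)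
  also have "0 \<le> \<dots>"
    using assms[unfolded positive_definite_fun_def, rule_format, of ?y] .
  finally show "0 \<le> (\<Sum>p | p permutes {0..<n}. \<Sum>q | q permutes {0..<n}.
          cnj (x p) * x q * (of_int (sign (q \<circ> inv p)) * F (q \<circ> inv p)))" .
qed

text \<open>The stabilisers of colourings \<open>c\<close> are the Young subgroups.\<close>

lemma young_subgroup_sum_nonneg:
  fixes c :: "nat \<Rightarrow> nat"
  assumes "positive_definite_fun n F"
  shows "0 \<le> cycle_sum 1 n (\<lambda>p. if \<forall>i<n. c (p i) = c i then F p else 0)"
proof -
  let ?S = "{p. p permutes {0..<n}}"
  define H where "H = {p. p permutes {0..<n} \<and> (\<forall>i<n. c (p i) = c i)}"
  have fin: "finite ?S" by (simp add: finite_permutations)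
  have sub: "H \<subseteq> ?S" by (auto simp: H_def)
  have idH: "id \<in> H" by (simp add: H_def permutes_id)
  have comp: "r \<circ> p \<in> H \<longleftrightarrow> r \<in> H" if p: "p \<in> H" and r: "r permutes {0..<n}" for p r
  proof -
    have perm: "p permutes {0..<n}" and cp: "\<And>i. i < n \<Longrightarrow> c (p i) = c i"
      using p by (auto simp: H_def)
    have im: "p ` {0..<n} = {0..<n}" using perm by (rule permutes_image)
    have "(\<forall>i<n. c (r i) = c i) \<longleftrightarrow> (\<forall>i\<in>p ` {0..<n}. c (r i) = c i)"
      unfolding im by auto
    also have "\<dots> \<longleftrightarrow> (\<forall>i<n. c (r (p i)) = c i)"
      using cp by auto
    finally show ?thesis
      using r perm by (auto simp: H_def intro: permutes_compose)
  qed
  have if_S: "(\<Sum>p\<in>?S. if p \<in> H then f p else 0) = (\<Sum>p\<in>H. f p)" for f :: "(nat \<Rightarrow> nat) \<Rightarrow> complex"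
    using fin sub by (simp add: sum.If_cases Int_absorb1)
  \<comment> \<open>The indicator of \<open>H\<close> is the test vector. Right translation by an
    element of \<open>H\<close> permutes \<open>H\<close>, so the double sum is
    \<open>card H\<close> times the wanted one.\<close>
  have "(\<Sum>q\<in>H. F (q \<circ> inv p)) = (\<Sum>q\<in>H. F q)" if p: "p \<in> H" for p
  proof -
    have perm: "p permutes {0..<n}" using p by (simp add: H_def)
    have "(\<Sum>q\<in>H. F (q \<circ> inv p)) = (\<Sum>q\<in>?S. if q \<in> H then F (q \<circ> inv p) else 0)"
      by (simp only: if_S)
    also have "\<dots> = (\<Sum>q\<in>?S. if q \<circ> p \<in> H then F (q \<circ> p \<circ> inv p) else 0)"
      by (rule sum_permutations_compose_right[OF perm])
    also have "\<dots> = (\<Sum>q\<in>?S. if q \<in> H then F q else 0)"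
      by (rule sum.cong) (auto simp: comp[OF p] comp_assoc permutes_inv_o[OF perm])
    finally show ?thesis by (simp only: if_S)
  qed
  then have "(\<Sum>p\<in>H. \<Sum>q\<in>H. F (q \<circ> inv p)) = of_nat (card H) * (\<Sum>q\<in>H. F q)"
    by simp
  moreover have "0 \<le> (\<Sum>p\<in>H. \<Sum>q\<in>H. F (q \<circ> inv p))"
  proof -
    let ?x = "\<lambda>p. if p \<in> H then 1 else 0 :: complex"
    have "0 \<le> (\<Sum>p\<in>?S. \<Sum>q\<in>?S. cnj (?x p) * ?x q * F (q \<circ> inv p))"
      using assms[unfolded positive_definite_fun_def, rule_format, of ?x] .
    also have "\<dots> = (\<Sum>p\<in>?S. if p \<in> H then (\<Sum>q\<in>?S. if q \<in> H then F (q \<circ> inv p) else 0) else 0)"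
      by (intro sum.cong refl) (auto intro!: sum.cong)
    finally show ?thesis by (simp only: if_S)
  qed
  moreover have "card H > 0"
    using idH finite_subset[OF sub fin] by (auto simp: card_gt_0_iff)
  ultimately have "0 \<le> (\<Sum>q\<in>H. F q)"
    by (auto intro: nonneg_of_nat_mult_cancel)
  also have "(\<Sum>q\<in>H. F q) = (\<Sum>p\<in>?S. if p \<in> H then F p else 0)"
    by (simp only: if_S)
  also have "\<dots> = cycle_sum 1 n (\<lambda>p. if \<forall>i<n. c (p i) = c i then F p else 0)"
    unfolding cycle_sum_one by (rule sum.cong) (auto simp: H_def)
  finally show ?thesis .
qed

text \<open>
  For \<open>0 \<le> b \<le> 1\<close> and \<open>1 \<le> n \<le> 4\<close> this is the least eigenvalue of the central group algebra element
  \<open>\<Sum>p. b ^ (n - \<nu> p) p\<close>. By Jucys and Murphy its eigenvalues are the products of \<open>1 + b c\<close> over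
  the contents \<open>c\<close> of the boxes of a Young diagram with \<open>n\<close> boxes.
\<close>

definition cycle_bound :: "real \<Rightarrow> nat \<Rightarrow> real" where
  "cycle_bound b n =
     (if n = 2 then 1 - b else if n = 3 then (1 - b) * (1 - 2 * b)
      else if n = 4 then (if b \<le> 1/2 then (1 - b) * (1 - 2 * b) * (1 - 3 * b) else (1 - b\<^sup>2) * (1 - 2 * b))
      else 1)"


section \<open>Explicit lower bounds on at most four letters\<close>

lemma cycle_sum_2: "cycle_sum \<beta> 2 f = f id + \<beta> * f (Transposition.transpose 1 0)"
  by (simp add: eval_nat_numeral cycle_sum_Suc)

lemma cycle_sum_3: "cycle_sum \<beta> 3 f = cycle_sum \<beta> 2 f
  + \<beta> * (cycle_sum \<beta> 2 (\<lambda>q. f (Transposition.transpose 2 0 \<circ> q))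
       + cycle_sum \<beta> 2 (\<lambda>q. f (Transposition.transpose 2 1 \<circ> q)))"
  using cycle_sum_Suc[of \<beta> 2 f] by (simp add: numeral_2_eq_2 numeral_3_eq_3)

lemma cycle_sum_4: "cycle_sum \<beta> 4 f = cycle_sum \<beta> 3 f
  + \<beta> * (cycle_sum \<beta> 3 (\<lambda>q. f (Transposition.transpose 3 0 \<circ> q))
       + cycle_sum \<beta> 3 (\<lambda>q. f (Transposition.transpose 3 1 \<circ> q))
       + cycle_sum \<beta> 3 (\<lambda>q. f (Transposition.transpose 3 2 \<circ> q)))"
proof -
  have "{..<3} = {0,1,2::nat}" by auto
  then show ?thesis using cycle_sum_Suc[of \<beta> 3 f] by (simp add: add.assoc)
qed

lemma All_less_3: "(\<forall>i<3. P (i::nat)) \<longleftrightarrow> P 0 \<and> P 1 \<and> P 2"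
  by (auto simp: numeral_3_eq_3 numeral_2_eq_2 less_Suc_eq)

lemma All_less_4: "(\<forall>i<4. P (i::nat)) \<longleftrightarrow> P 0 \<and> P 1 \<and> P 2 \<and> P 3"
proof -
  have "i < 4 \<longleftrightarrow> i = 0 \<or> i = 1 \<or> i = 2 \<or> i = 3" for i :: nat by auto
  then show ?thesis by auto
qed

lemma cycle_sum_one_nonneg:
  assumes "positive_definite_fun n F"
  shows "0 \<le> cycle_sum 1 n F"
  using young_subgroup_sum_nonneg[OF assms, of "\<lambda>_. 0"] by simp

lemma cycle_sum_minus_one_nonneg:
  assumes "positive_definite_fun n F"
  shows "0 \<le> cycle_sum (- 1) n F"
  using cycle_sum_one_nonneg[OF positive_definite_fun_sign[OF assms]] by (simp add: cycle_sum_sign)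

lemma cycle_sum_2_ge:
  assumes F: "positive_definite_fun 2 F" and b: "0 \<le> b"
  shows "complex_of_real (1 - b) * F id \<le> cycle_sum (complex_of_real b) 2 F"
proof -
  have "cycle_sum (complex_of_real b) 2 F - complex_of_real (1 - b) * F id = b * cycle_sum 1 2 F"
    by (simp add: cycle_sum_2 algebra_simps)
  also have "0 \<le> \<dots>"
    by (intro scaled_nonneg b cycle_sum_one_nonneg F)
  finally show ?thesis by simp
qed

lemma cycle_sum_3_ge:
  assumes F: "positive_definite_fun 3 F" and b: "0 \<le> b" "b \<le> 1"
  shows "complex_of_real ((1 - b) * (1 - 2 * b)) * F id \<le> cycle_sum (complex_of_real b) 3 F"
proof -
  define X where "X c = cycle_sum 1 3 (\<lambda>p. if \<forall>i<3. c (p i) = c i then F p else 0)"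
    for c :: "nat \<Rightarrow> nat"
  have X: "0 \<le> X c" for c unfolding X_def by (intro young_subgroup_sum_nonneg F)
  \<comment> \<open>The stabiliser of each colouring consists of the identity and the transposition
    of the two letters other than \<open>k\<close>.\<close>
  define M where "M = (\<Sum>k\<in>{0,1,2}. X (\<lambda>i. if i = k then 1 else 0))"
  \<comment> \<open>The 3-cycles occur only in the sum over the whole group, which forces its
    coefficient; the transpositions then determine the other one.\<close>
  have "cycle_sum (complex_of_real b) 3 F - complex_of_real ((1 - b) * (1 - 2 * b)) * F id
    = complex_of_real (b * (1 - b)) * M + complex_of_real (b\<^sup>2) * cycle_sum 1 3 F"
    unfolding M_def X_def cycle_sum_3 cycle_sum_2 All_less_3
    by (simp add: Transposition.transpose_def algebra_simps power2_eq_square)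
  also have "0 \<le> \<dots>"
    unfolding M_def using b
    by (intro scaled_nonneg add_nonneg_nonneg sum_nonneg X cycle_sum_one_nonneg F) auto
  finally show ?thesis by simp
qed

text \<open>
  The coefficients come from decomposing the characters of \<open>S\<^sub>4\<close>. For \<open>b > 1/2\<close> the irreducible
  \<open>(2,1,1)\<close> has the least eigenvalue, so it must not occur; the permutation modules of type
  \<open>(4)\<close>, \<open>(3,1)\<close>, \<open>(2,2)\<close> and the sign representation avoid it.
\<close>

lemma cycle_sum_4_ge:
  assumes F: "positive_definite_fun 4 F" and b: "0 \<le> b" "b \<le> 1"
  shows "complex_of_real (cycle_bound b 4) * F id \<le> cycle_sum (complex_of_real b) 4 F"
proof -
  define X where "X c = cycle_sum 1 4 (\<lambda>p. if \<forall>i<4. c (p i) = c i then F p else 0)"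
    for c :: "nat \<Rightarrow> nat"
  have X: "0 \<le> X c" for c unfolding X_def by (intro young_subgroup_sum_nonneg F)
  \<comment> \<open>Each sum runs over all conjugates of a Young subgroup: four point stabilisers,
    three splittings into two pairs (\<open>k\<close> is the partner of 0), and six subgroups
    generated by a transposition.\<close>
  define M31 where "M31 = (\<Sum>k\<in>{0,1,2,3}. X (\<lambda>i. if i = k then 1 else 0))"
  define M22 where "M22 = (\<Sum>k\<in>{1,2,3}. X (\<lambda>i. if i = 0 \<or> i = k then 1 else 0))"
  define M211 where
    "M211 = (\<Sum>(j, k)\<in>{(0,1),(0,2),(0,3),(1,2),(1,3),(2,3)}. X (\<lambda>i. if i = k then j else i))"
  have M: "0 \<le> M31" "0 \<le> M22" "0 \<le> M211"
    unfolding M31_def M22_def M211_def by (auto intro!: sum_nonneg X simp del: sum.insert)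
  note expand = X_def cycle_sum_4 cycle_sum_3 cycle_sum_2 All_less_4
  show ?thesis
  proof (cases "b \<le> 1/2")
    case True
    have "cycle_sum (complex_of_real b) 4 F
          - complex_of_real ((1 - b) * (1 - 2 * b) * (1 - 3 * b)) * F id
      = complex_of_real (b ^ 3) * cycle_sum 1 4 F + complex_of_real (b\<^sup>2 * (1 - b)) * (M31 + M22)
        + complex_of_real (b * (1 - b) * (1 - 2 * b)) * M211"
      unfolding M31_def M22_def M211_def expand
      by (simp add: Transposition.transpose_def)
         (simp add: algebra_simps power2_eq_square power3_eq_cube)
    also have "0 \<le> \<dots>"
      using b True by (intro scaled_nonneg add_nonneg_nonneg M cycle_sum_one_nonneg F) auto
    finally show ?thesis using True by (simp add: cycle_bound_def)
  next
    case False
    \<comment> \<open>The factor 6 clears denominators; \<open>b > 1/2\<close> makes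
      \<open>2 * b - 1\<close> and \<open>4 * b - 1\<close> positive.\<close>
    have "complex_of_real 6 * (cycle_sum (complex_of_real b) 4 F - complex_of_real ((1 - b\<^sup>2) * (1 - 2 * b)) * F id)
      = complex_of_real (b * (1 - b) * (2 * b - 1)) * cycle_sum (-1) 4 F
        + complex_of_real (2 * b * ((1 - b) * (1 + b))) * (M31 + M22)
        + complex_of_real (b * (4 * b - 1) * (b + 1)) * cycle_sum 1 4 F"
      unfolding M31_def M22_def expand
      by (simp add: Transposition.transpose_def)
         (simp add: algebra_simps power2_eq_square power3_eq_cube)
    also have "0 \<le> \<dots>"
      using b False
      by (intro scaled_nonneg add_nonneg_nonneg M cycle_sum_one_nonneg cycle_sum_minus_one_nonneg F) auto
    finally show ?thesis using False by (simp add: cycle_bound_def less_eq_complex_def)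
  qed
qed

lemma cycle_sum_ge_nonneg:
  assumes F: "positive_definite_fun n F" and n: "n \<le> 4" and b: "0 \<le> b" "b \<le> 1"
  shows "complex_of_real (cycle_bound b n) * F id \<le> cycle_sum (complex_of_real b) n F"
proof -
  consider "n = 0" | "n = Suc 0" | "n = 2" | "n = 3" | "n = 4" using n by linarith
  then show ?thesis
    using assms cycle_sum_2_ge[of F b] cycle_sum_3_ge[of F b] cycle_sum_4_ge[of F b]
    by cases (simp_all add: cycle_bound_def cycle_sum_Suc)
qed

text \<open>For negative \<open>b\<close>, twisting \<open>F\<close> by the sign replaces
  \<open>b\<close> by its absolute value and keeps \<open>F id\<close>.\<close>

lemma cycle_sum_ge:
  assumes F: "positive_definite_fun n F" and n: "n \<le> 4" and b: "\<bar>b\<bar> \<le> 1"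
  shows "complex_of_real (cycle_bound \<bar>b\<bar> n) * F id \<le> cycle_sum (complex_of_real b) n F"
proof (cases "0 \<le> b")
  case True
  then show ?thesis using cycle_sum_ge_nonneg[OF F n] b by simp
next
  case False
  have "complex_of_real (cycle_bound \<bar>b\<bar> n) * (of_int (sign id) * F id)
      \<le> cycle_sum (complex_of_real \<bar>b\<bar>) n (\<lambda>p. of_int (sign p) * F p)"
    using cycle_sum_ge_nonneg[OF positive_definite_fun_sign[OF F] n, of "\<bar>b\<bar>"] b by simp
  then show ?thesis using False by (simp add: cycle_sum_sign)
qed

subsection \<open>Removing the last index\<close>

text \<open>The \<open>i\<close>-th summand belongs to the permutation that sends \<open>i\<close> to \<open>n\<close> and \<open>n\<close> to \<open>q i\<close>.\<close>

definition cycle_insertion :: "(nat \<Rightarrow> nat \<Rightarrow> complex) \<Rightarrow> nat \<Rightarrow> (nat \<Rightarrow> nat) \<Rightarrow> complex" where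
  "cycle_insertion A n q = (\<Sum>i<n. A i n * A n (q i) * (\<Prod>j\<in>{..<n} - {i}. A j (q j)))"

lemma cycle_sum_prod_Suc:
  "cycle_sum \<beta> (Suc n) (\<lambda>p. \<Prod>i<Suc n. A i (p i)) =
     A n n * cycle_sum \<beta> n (\<lambda>p. \<Prod>i<n. A i (p i)) + \<beta> * cycle_sum \<beta> n (cycle_insertion A n)"
proof -
  have 1: "cycle_sum \<beta> n (\<lambda>p. \<Prod>i<Suc n. A i (p i)) = A n n * cycle_sum \<beta> n (\<lambda>p. \<Prod>i<n. A i (p i))"
    unfolding cycle_sum_scale[symmetric]
    by (rule cycle_sum_cong) (simp add: permutes_def)
  have 2: "(\<Sum>b<n. \<Prod>i<Suc n. A i ((Transposition.transpose n b \<circ> q) i)) = cycle_insertion A n q"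
    if q: "q permutes {0..<n}" for q
  proof -
    have qn: "q n = n" using q by (simp add: permutes_def)
    have lt: "q i < n" if "i < n" for i using permutes_in_image[OF q, of i] that by simp
    have inj: "q i = q j \<longleftrightarrow> i = j" for i j using permutes_inj[OF q] by (simp add: inj_eq)
    \<comment> \<open>Substituting \<open>b = q k\<close> makes \<open>k\<close> the index that is
      sent to \<open>n\<close>.\<close>
    have "(\<Sum>b<n. \<Prod>i<Suc n. A i ((Transposition.transpose n b \<circ> q) i))
       = (\<Sum>k<n. \<Prod>i<Suc n. A i ((Transposition.transpose n (q k) \<circ> q) i))"
      using sum.permute[OF q, of "\<lambda>b. \<Prod>i<Suc n. A i ((Transposition.transpose n b \<circ> q) i)"]
      by (simp add: o_def atLeast0LessThan)
    also have "\<dots> = cycle_insertion A n q"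
      unfolding cycle_insertion_def
    proof (rule sum.cong[OF refl])
      fix k assume k: "k \<in> {..<n}"
      have "(\<Prod>i<n. A i (Transposition.transpose n (q k) (q i)))
        = A k n * (\<Prod>i\<in>{..<n} - {k}. A i (Transposition.transpose n (q k) (q i)))"
        using prod.remove[OF _ k, of "\<lambda>i. A i (Transposition.transpose n (q k) (q i))"] by simp
      also have "(\<Prod>i\<in>{..<n} - {k}. A i (Transposition.transpose n (q k) (q i)))
         = (\<Prod>i\<in>{..<n} - {k}. A i (q i))"
        by (rule prod.cong) (use lt inj in \<open>auto simp: Transposition.transpose_def dest: lt\<close>)
      finally show "(\<Prod>i<Suc n. A i ((Transposition.transpose n (q k) \<circ> q) i))
         = A k n * A n (q k) * (\<Prod>j\<in>{..<n} - {k}. A j (q j))"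
        by (simp add: qn mult_ac)
    qed
    finally show ?thesis .
  qed
  have "cycle_sum \<beta> n (\<lambda>q. \<Sum>b<n. \<Prod>i<Suc n. A i ((Transposition.transpose n b \<circ> q) i))
      = cycle_sum \<beta> n (cycle_insertion A n)"
    by (rule cycle_sum_cong) (rule 2)
  then show ?thesis
    unfolding cycle_sum_Suc 1 cycle_sum_sum[symmetric] by (simp only:)
qed

text \<open>After the substitution \<open>i = p l\<close>, each summand is a rank one kernel in
  \<open>p\<close> and \<open>q\<close>, absorbed into the test vector as \<open>?y l\<close>, times
  a Schur product of Gram kernels.\<close>

lemma positive_definite_cycle_insertion:
  assumes A: "gram_on {..<m} A" and n: "n < m"
  shows "positive_definite_fun n (cycle_insertion A n)"
  unfolding positive_definite_fun_def
proof
  fix x :: "(nat \<Rightarrow> nat) \<Rightarrow> complex"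
  let ?S = "{p. p permutes {0..<n}}"
  have lt: "p i < n" if "p \<in> ?S" "i < n" for p i
    using permutes_in_image[of p "{0..<n}" i] that by simp
  let ?y = "\<lambda>l p. A n (p l) * x p"
  have "(\<Sum>p\<in>?S. \<Sum>q\<in>?S. cnj (x p) * x q * cycle_insertion A n (q \<circ> inv p)) =
    (\<Sum>p\<in>?S. \<Sum>q\<in>?S. \<Sum>l<n. cnj (?y l p) * ?y l q * (\<Prod>j\<in>{..<n} - {l}. A (p j) (q j)))"
  proof (intro sum.cong refl)
    fix p q assume pS: "p \<in> ?S" and qS: "q \<in> ?S"
    have p: "p permutes {0..<n}" using pS by simp
    have "cycle_insertion A n (q \<circ> inv p) =
      (\<Sum>l<n. A (p l) n * A n (q l) * (\<Prod>j\<in>{..<n} - {p l}. A j (q (inv p j))))"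
      unfolding cycle_insertion_def
      using sum.permute[OF p, of "\<lambda>i. A i n * A n (q (inv p i)) * (\<Prod>j\<in>{..<n} - {i}. A j (q (inv p j)))"]
      by (simp add: o_def atLeast0LessThan permutes_inverses[OF p])
    also have "\<dots> = (\<Sum>l<n. cnj (A n (p l)) * A n (q l) * (\<Prod>j\<in>{..<n} - {l}. A (p j) (q j)))"
    proof (rule sum.cong[OF refl])
      fix l assume l: "l \<in> {..<n}"
      have "p ` ({..<n} - {l}) = {..<n} - {p l}"
        using permutes_image[OF p] permutes_inj[OF p]
        by (simp add: image_set_diff atLeast0LessThan)
      then have "(\<Prod>j\<in>{..<n} - {p l}. A j (q (inv p j))) = (\<Prod>j\<in>{..<n} - {l}. A (p j) (q j))"
        using prod.reindex[OF permutes_inj_on[OF p], of "\<lambda>j. A j (q (inv p j))" "{..<n} - {l}"]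
        by (simp add: o_def permutes_inverses[OF p])
      moreover have "A (p l) n = cnj (A n (p l))"
        using lt[OF pS, of l] l n by (intro gram_on_cnj[OF A]) auto
      ultimately show "A (p l) n * A n (q l) * (\<Prod>j\<in>{..<n} - {p l}. A j (q (inv p j)))
         = cnj (A n (p l)) * A n (q l) * (\<Prod>j\<in>{..<n} - {l}. A (p j) (q j))"
        by simp
    qed
    finally show "cnj (x p) * x q * cycle_insertion A n (q \<circ> inv p) =
      (\<Sum>l<n. cnj (?y l p) * ?y l q * (\<Prod>j\<in>{..<n} - {l}. A (p j) (q j)))"
      by (simp add: sum_distrib_left mult_ac)
  qed
  also have "\<dots> = (\<Sum>l<n. \<Sum>p\<in>?S. \<Sum>q\<in>?S. cnj (?y l p) * ?y l q * (\<Prod>j\<in>{..<n} - {l}. A (p j) (q j)))"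
    by (simp add: sum.swap[of _ _ "{..<n}"])
  also have "0 \<le> \<dots>"
    using lt n
    by (intro sum_nonneg gram_kernel_product_nonneg[OF A, where f = "\<lambda>j p. p j"])
       (auto intro: less_trans)
  finally show "0 \<le> (\<Sum>p\<in>?S. \<Sum>q\<in>?S. cnj (x p) * x q * cycle_insertion A n (q \<circ> inv p))" .
qed

text \<open>For distinct \<open>i\<close> and \<open>k\<close> below \<open>n\<close> this is the
  matrix product belonging to the transposition of \<open>i\<close> and \<open>k\<close>.\<close>

definition diag_pair :: "(nat \<Rightarrow> nat \<Rightarrow> complex) \<Rightarrow> nat \<Rightarrow> nat \<Rightarrow> nat \<Rightarrow> complex" where
  "diag_pair A n i k = A i k * A k i * (\<Prod>j\<in>{..<n} - {i, k}. A j j)"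

lemma diag_pair_nonneg:
  assumes A: "gram_on {..<n} A" and "i < n" "k < n"
  shows "0 \<le> diag_pair A n i k"
proof -
  have "A i k * A k i = cnj (A k i) * A k i"
    using gram_on_cnj[OF A, of k i] assms by simp
  then have "0 \<le> A i k * A k i" by (simp only: nonneg_cnj_mult_self)
  moreover have "0 \<le> (\<Prod>j\<in>{..<n} - {i, k}. A j j)"
    by (intro prod_nonneg_complex gram_on_diag_nonneg[OF A]) auto
  ultimately show ?thesis unfolding diag_pair_def by (rule mult_nonneg_nonneg)
qed

text \<open>Dividing by \<open>b\<close> covers both signs at once. In the induction, earlier pairs
  gain the factor \<open>A n n\<close>, while \<open>cycle_sum_ge\<close>, used on at most four
  letters, gives the pairs containing the new index \<open>n\<close>.\<close>

lemma cycle_sum_prod_minus_diag_ge: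
  assumes A: "gram_on {..<n} A" and n: "n \<le> 5" and b: "\<bar>b\<bar> \<le> 1" "b \<noteq> 0"
  shows "(\<Sum>k<n. complex_of_real (cycle_bound \<bar>b\<bar> k) * (\<Sum>i<k. diag_pair A n i k))
     \<le> (cycle_sum (complex_of_real b) n (\<lambda>p. \<Prod>i<n. A i (p i)) - (\<Prod>i<n. A i i)) / complex_of_real b"
  using A n
proof (induction n)
  case 0
  then show ?case by simp
next
  case (Suc n)
  let ?c = "\<lambda>k. complex_of_real (cycle_bound \<bar>b\<bar> k)"
  let ?P = "\<lambda>n. cycle_sum (complex_of_real b) n (\<lambda>p. \<Prod>i<n. A i (p i))"
  have A: "gram_on {..<n} A" using Suc.prems(1) by (rule gram_on_subset) auto
  have Ann: "0 \<le> A n n" using Suc.prems(1) by (rule gram_on_diag_nonneg) simp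
  have step: "diag_pair A (Suc n) i k = A n n * diag_pair A n i k" if "i < k" "k < n" for i k
  proof -
    have "{..<Suc n} - {i, k} = insert n ({..<n} - {i, k})" using that by auto
    then show ?thesis by (simp add: diag_pair_def)
  qed
  have last: "(\<Sum>i<n. diag_pair A (Suc n) i n) = cycle_insertion A n id"
    unfolding cycle_insertion_def diag_pair_def
  proof (rule sum.cong[OF refl])
    fix i assume "i \<in> {..<n}"
    then have "{..<Suc n} - {i, n} = {..<n} - {i}" by auto
    then show "A i n * A n i * (\<Prod>j\<in>{..<Suc n} - {i, n}. A j j) =
      A i n * A n (id i) * (\<Prod>j\<in>{..<n} - {i}. A j (id j))" by simp
  qed
  have "(\<Sum>k<Suc n. ?c k * (\<Sum>i<k. diag_pair A (Suc n) i k)) =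
    A n n * (\<Sum>k<n. ?c k * (\<Sum>i<k. diag_pair A n i k)) + ?c n * cycle_insertion A n id"
  proof -
    have "?c k * (\<Sum>i<k. diag_pair A (Suc n) i k) = A n n * (?c k * (\<Sum>i<k. diag_pair A n i k))"
      if "k < n" for k
      using that by (simp add: step sum_distrib_left mult.left_commute)
    then have "(\<Sum>k<n. ?c k * (\<Sum>i<k. diag_pair A (Suc n) i k))
        = A n n * (\<Sum>k<n. ?c k * (\<Sum>i<k. diag_pair A n i k))"
      by (subst sum_distrib_left[of "A n n"], intro sum.cong) auto
    then show ?thesis
      by (simp only: sum.lessThan_Suc last)
  qed
  also have "\<dots> \<le> A n n * ((?P n - (\<Prod>i<n. A i i)) / b) + cycle_sum b n (cycle_insertion A n)"
    using Suc.prems(2) b(1)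
    by (intro add_mono mult_left_mono Suc.IH A Ann cycle_sum_ge
          positive_definite_cycle_insertion[OF Suc.prems(1)]) auto
  also have "\<dots> = (?P (Suc n) - (\<Prod>i<Suc n. A i i)) / b"
    unfolding cycle_sum_prod_Suc using b(2) by (simp add: field_simps)
  finally show ?case .
qed

section \<open>Averaging over all orderings of the indices\<close>

lemma diag_pair_relabel:
  assumes s: "s permutes {0..<n}"
  shows "diag_pair (\<lambda>i j. A (s i) (s j)) n i k = diag_pair A n (s i) (s k)"
proof -
  have "s ` ({..<n} - {i, k}) = {..<n} - {s i, s k}"
    using permutes_image[OF s] permutes_inj[OF s]
    by (simp add: image_set_diff atLeast0LessThan)
  then have "(\<Prod>j\<in>{..<n} - {s i, s k}. A j j) = (\<Prod>j\<in>{..<n} - {i, k}. A (s j) (s j))"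
    using prod.reindex[OF permutes_inj_on[OF s], of "\<lambda>j. A j j" "{..<n} - {i, k}"]
    by (simp add: o_def)
  then show ?thesis by (simp add: diag_pair_def)
qed

lemma sum_permutations_pair_eq:
  fixes f :: "nat \<Rightarrow> nat \<Rightarrow> complex"
  assumes "i < k" "k < n"
  shows "(\<Sum>s | s permutes {0..<n}. f (s i) (s k)) = (\<Sum>s | s permutes {0..<n}. f (s 0) (s 1))"
proof -
  \<comment> \<open>The permutation \<open>t\<close> must send 0 to \<open>i\<close> and 1 to
    \<open>k\<close>. Its second factor undoes the change that the first would make to
    \<open>k\<close>; since \<open>k'\<close> is not 0, the image of 0 stays
    \<open>i\<close>.\<close>
  define k' where "k' = Transposition.transpose 0 i k"
  define t where "t = Transposition.transpose 0 i \<circ> Transposition.transpose 1 k'"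
  have k': "k' < n" "k' \<noteq> 0" using assms by (auto simp: k'_def Transposition.transpose_def)
  have t: "t permutes {0..<n}"
    unfolding t_def using assms k' by (intro permutes_compose permutes_swap_id) auto
  have "t 0 = i" "t 1 = k"
    using k' by (simp_all add: t_def) (simp add: k'_def)
  then show ?thesis
    using sum_permutations_compose_right[OF t, of "\<lambda>s. f (s 0) (s 1)"] by simp
qed

lemma cycle_bound_sum_nonneg:
  assumes "n \<le> 5" "0 \<le> b" "b \<le> 1"
  shows "0 \<le> (\<Sum>k<n. real k * cycle_bound b k)"
proof -
  \<comment> \<open>The three polynomials are the weighted sum for \<open>n = 4\<close> and, on
    either side of \<open>b = 1/2\<close>, for \<open>n = 5\<close>.\<close>
  have n4: "0 \<le> 6 - 11 * b + 6 * b\<^sup>2"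
  proof -
    have "6 - 11 * b + 6 * b\<^sup>2 = 6 * (b - 11/12)\<^sup>2 + 23/24" by (simp add: power2_eq_square algebra_simps)
    then show ?thesis by simp
  qed
  have n5_small: "0 \<le> 10 - 35 * b + 50 * b\<^sup>2 - 24 * b ^ 3" if "b \<le> 1/2"
  proof -
    \<comment> \<open>Taylor expansion at 1/2, where all coefficients in powers of
      \<open>1/2 - b\<close> are positive.\<close>
    have "10 - 35 * b + 50 * b\<^sup>2 - 24 * b ^ 3
        = 2 + 3 * (1/2 - b) + 14 * (1/2 - b)\<^sup>2 + 24 * (1/2 - b) ^ 3"
      by (simp add: power2_eq_square power3_eq_cube algebra_simps)
    also have "0 \<le> \<dots>" using that by (intro add_nonneg_nonneg) auto
    finally show ?thesis .
  qed
  have n5_large: "0 \<le> 10 - 19 * b + 2 * b\<^sup>2 + 8 * b ^ 3"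
  proof -
    \<comment> \<open>The linear part is the tangent at 4/5, a point close to the minimiser; it is
      still positive at \<open>b = 1\<close>.\<close>
    have "10 - 19 * b + 2 * b\<^sup>2 + 8 * b ^ 3 = (b - 4/5)\<^sup>2 * (8 * b + 74/5) + (66/125) - 11/25 * b"
      by (simp add: power2_eq_square power3_eq_cube algebra_simps)
    moreover have "0 \<le> (b - 4/5)\<^sup>2 * (8 * b + 74/5)" using assms by simp
    ultimately show ?thesis using assms by linarith
  qed
  consider "n = 0" | "n = Suc 0" | "n = 2" | "n = 3" | "n = 4" | "n = 5" using assms by linarith
  then show ?thesis
    using n4 n5_small n5_large assms
    by cases (auto simp: cycle_bound_def eval_nat_numeral algebra_simps)
qed

text \<open>The quantity \<open>?R A\<close> is invariant under relabelling, so the lower bounds for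
  all orderings may be averaged. Every pair then contributes the same total \<open>T\<close>, with
  overall coefficient the sum of \<open>k * cycle_bound \<bar>b\<bar> k\<close>.\<close>

lemma cycle_sum_prod_minus_diag_nonneg:
  assumes A: "gram_on {..<n} A" and n: "n \<le> 5" and b: "\<bar>b\<bar> \<le> 1" "b \<noteq> 0"
  shows "0 \<le> (cycle_sum (complex_of_real b) n (\<lambda>p. \<Prod>i<n. A i (p i)) - (\<Prod>i<n. A i i)) / complex_of_real b"
    (is "0 \<le> ?R A")
proof -
  let ?S = "{s. s permutes {0..<n}}"
  let ?c = "\<lambda>k. complex_of_real (cycle_bound \<bar>b\<bar> k)"
  define T where "T = (\<Sum>s\<in>?S. diag_pair A n (s 0) (s 1))"
  have lt: "s i < n" if "s \<in> ?S" "i < n" for s i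
    using permutes_in_image[of s "{0..<n}" i] that by simp
  have relabel: "?R A = ?R (\<lambda>i j. A (s i) (s j))" if "s \<in> ?S" for s
  proof -
    have s: "s permutes {0..<n}" using that by simp
    have "(\<Prod>i<n. A (s i) (s i)) = (\<Prod>i<n. A i i)"
      using prod.permute[OF s, of "\<lambda>i. A i i"] by (simp add: o_def atLeast0LessThan)
    then show ?thesis using cycle_sum_relabel[OF s, of _ A] by simp
  qed
  have "(\<Sum>k<n. ?c k * (\<Sum>i<k. diag_pair A n (s i) (s k))) \<le> ?R A" if s: "s \<in> ?S" for s
  proof -
    have "gram_on (s ` {..<n}) A"
      using A s permutes_image[of s "{0..<n}"] by (simp add: atLeast0LessThan)
    then have "gram_on {..<n} (\<lambda>i j. A (s i) (s j))" by (rule gram_on_relabel)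
    from cycle_sum_prod_minus_diag_ge[OF this n b] show ?thesis
      unfolding relabel[OF s] using s by (simp add: diag_pair_relabel)
  qed
  then have "(\<Sum>s\<in>?S. \<Sum>k<n. ?c k * (\<Sum>i<k. diag_pair A n (s i) (s k))) \<le> (\<Sum>s\<in>?S. ?R A)"
    by (intro sum_mono)
  also have "(\<Sum>s\<in>?S. \<Sum>k<n. ?c k * (\<Sum>i<k. diag_pair A n (s i) (s k)))
      = (\<Sum>k<n. ?c k * (\<Sum>i<k. \<Sum>s\<in>?S. diag_pair A n (s i) (s k)))"
    by (subst sum.swap) (simp add: sum_distrib_left[symmetric] sum.swap[of _ _ ?S])
  also have "\<dots> = (\<Sum>k<n. ?c k * (\<Sum>i<k. T))"
    unfolding T_def
    by (intro sum.cong arg_cong2[where f = "(*)"] sum_permutations_pair_eq refl) auto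
  also have "\<dots> = complex_of_real (\<Sum>k<n. real k * cycle_bound \<bar>b\<bar> k) * T"
    by (simp add: sum_distrib_left mult_ac)
  finally have "complex_of_real (\<Sum>k<n. real k * cycle_bound \<bar>b\<bar> k) * T \<le> of_nat (card ?S) * ?R A"
    by simp
  moreover have "0 \<le> complex_of_real (\<Sum>k<n. real k * cycle_bound \<bar>b\<bar> k) * T"
  \<comment> \<open>Nonnegativity of \<open>T\<close> needs 0 and 1 to be indices; for smaller
    \<open>n\<close> the coefficient of \<open>T\<close> is 0.\<close>
  proof (cases "n \<ge> 2")
    case True
    then have "0 \<le> diag_pair A n (s 0) (s 1)" if "s \<in> ?S" for s
      using lt[OF that, of 0] lt[OF that, of 1] by (intro diag_pair_nonneg[OF A]) auto
    then have "0 \<le> T" unfolding T_def by (rule sum_nonneg)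
    then show ?thesis using n b by (intro scaled_nonneg cycle_bound_sum_nonneg) auto
  next
    case False
    then have "n = 0 \<or> n = Suc 0" by linarith
    then show ?thesis by auto
  qed
  ultimately have "0 \<le> of_nat (card ?S) * ?R A" by (rule order_trans[rotated])
  moreover have "card ?S > 0" by (simp add: card_permutations)
  ultimately show ?thesis
    by (rule nonneg_of_nat_mult_cancel[rotated])
qed

theorem mainTheorem8:
  fixes \<alpha> :: real and n :: nat and A :: "nat \<Rightarrow> nat \<Rightarrow> complex"
  assumes "\<alpha> \<ge> 1" and "n \<le> 5"
    and "hermitian_mat n A" and "psd_mat n A"
  shows "per_alpha (complex_of_real \<alpha>) n A \<ge> complex_of_real \<alpha> ^ n * (\<Prod>i<n. A i i)
     \<and> complex_of_real \<alpha> ^ n * (\<Prod>i<n. A i i) \<ge> (-1) ^ n * per_alpha (- complex_of_real \<alpha>) n A"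
proof
  let ?W = "\<Prod>i<n. A i i"
  let ?P = "\<lambda>b. cycle_sum b n (\<lambda>p. \<Prod>i<n. A i (p i))"
  have A: "gram_on {..<n} A" using assms(3,4) by (rule gram_on_of_psd_mat)
  have \<alpha>: "0 \<le> complex_of_real \<alpha> ^ n" "complex_of_real \<alpha> \<noteq> 0"
    using assms(1) by (auto simp: less_eq_complex_def simp flip: of_real_power)
  \<comment> \<open>Taking \<open>b = 1 / \<alpha>\<close> and multiplying by it clears the
    quotient.\<close>
  have "0 \<le> complex_of_real (1 / \<alpha>) * ((?P (complex_of_real (1 / \<alpha>)) - ?W) / complex_of_real (1 / \<alpha>))"
    using assms(1) by (intro scaled_nonneg cycle_sum_prod_minus_diag_nonneg A assms(2)) auto
  then have "?W \<le> ?P (1 / complex_of_real \<alpha>)"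
    using \<alpha> by simp
  then show "complex_of_real \<alpha> ^ n * ?W \<le> per_alpha (complex_of_real \<alpha>) n A"
    unfolding per_alpha_eq_cycle_sum[OF \<alpha>(2)] by (rule mult_left_mono[OF _ \<alpha>(1)])
  \<comment> \<open>Now \<open>b = - 1 / \<alpha>\<close>, but the multiplier is still positive, so
    the difference changes sign.\<close>
  have "0 \<le> complex_of_real (1 / \<alpha>) * ((?P (complex_of_real (- 1 / \<alpha>)) - ?W) / complex_of_real (- 1 / \<alpha>))"
    using assms(1) by (intro scaled_nonneg cycle_sum_prod_minus_diag_nonneg A assms(2)) auto
  then have "?P (1 / - complex_of_real \<alpha>) \<le> ?W"
    using \<alpha> by simp
  moreover have "(-1) ^ n * per_alpha (- complex_of_real \<alpha>) n A = complex_of_real \<alpha> ^ n * ?P (1 / - complex_of_real \<alpha>)"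
    using per_alpha_eq_cycle_sum[of "- complex_of_real \<alpha>" n A] \<alpha>(2)
    by (simp add: mult.assoc[symmetric] power_mult_distrib[symmetric])
  ultimately show "(-1) ^ n * per_alpha (- complex_of_real \<alpha>) n A \<le> complex_of_real \<alpha> ^ n * ?W"
    using mult_left_mono[OF _ \<alpha>(1)] by simp
qed

end
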